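(* Let $(\mathcal{X},\sigma)$ be a FAD-system whose growth rate satisfies $\Lambda>1$. Then $\Lambda$ is finite, and the Cesàro mean $$B:=\lim_{X\to+\infty}\frac1X\sum_{k\le X}\frac{\sigma_k}{\Lambda^k}$$ exists and satisfies $B>0$.
   Context: For a self-map $\sigma\colon\mathcal{X}\to\mathcal{X}$ of a set and $k\ge1$, $\sigma_k$ is the number of fixed points of the $k$-th iterate $\sigma^k$. The map $\sigma$ is confined if $\sigma_k$ is finite for all $k\geq 1$. The growth rate is $\Lambda:=\exp\limsup_{k\to\infty}\log(\sigma_k)/k$ (a priori possibly $+\infty$). A sequence of real numbers $(a_k)_{k\ge1}$ is called a periodic gcd-sequence of period $\varpi\in\mathbf{Z}_{>0}$ if it is periodic of period $\varpi$ and $a_k=a_{\gcd(k,\varpi)}$ for all $k\ge1$. A pair $(\mathcal{X},\sigma)$ consisting of a set and a confined self-map is a FAD-system if for all $k\ge1$ $$\sigma_k=c^k\,|\det(A^k-1)|\,r_k\prod_{p\in S}|k|_p^{s_{p,k}}\,p^{-t_{p,k}|k|_p^{-1}},$$ where $c\in\mathbf{R}_{>0}$; $A$ is a square integral matrix (with the convention that the entire factor $|\det(A^k-1)|$ may be absent); $(r_k)$ is a periodic gcd-sequence with values in $\mathbf{R}_{>0}$; $S$ is a finite set of primes; and for each $p\in S$, $(s_{p,k})_k$ and $(t_{p,k})_k$ are periodic gcd-sequences with values in $\mathbf{R}_{\ge0}$ and of period coprime to $p$. Here $|k|_p=p^{-v_p(k)}$ is the $p$-adic absolute value. *)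

theory Defs
  imports
    Complex_Main
    "HOL-Library.Extended_Real"
    "HOL-Library.Liminf_Limsup"
    "HOL-Computational_Algebra.Primes"
    "Jordan_Normal_Form.Determinant"
begin

text \<open>Here \<open>\<sigma>\<close> is a total function on the ambient type; only its restriction to \<open>X\<close> matters, and
  self-maps of \<open>X\<close> are those with \<open>\<sigma> ` X \<subseteq> X\<close>.\<close>

definition fixpoints :: "'a set \<Rightarrow> ('a \<Rightarrow> 'a) \<Rightarrow> nat \<Rightarrow> 'a set" where
  "fixpoints X \<sigma> k = {x \<in> X. (\<sigma> ^^ k) x = x}"

definition fix_count :: "'a set \<Rightarrow> ('a \<Rightarrow> 'a) \<Rightarrow> nat \<Rightarrow> nat" where
  "fix_count X \<sigma> k = card (fixpoints X \<sigma> k)"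

definition confined :: "'a set \<Rightarrow> ('a \<Rightarrow> 'a) \<Rightarrow> bool" where
  "confined X \<sigma> \<longleftrightarrow> \<sigma> ` X \<subseteq> X \<and> (\<forall>k\<ge>1. finite (fixpoints X \<sigma> k))"

text \<open>Extended logarithm and exponential, with \<open>log 0 = -\<infinity>\<close>, \<open>exp (-\<infinity>) = 0\<close>, \<open>exp \<infinity> = \<infinity>\<close>.
  (The library's real logarithm has \<open>ln 0 = 0\<close>, which would be wrong when \<open>\<sigma>\<^sub>k = 0\<close>.)\<close>

definition ext_ln :: "nat \<Rightarrow> ereal" where
  "ext_ln m = (if m = 0 then -\<infinity> else ereal (ln (real m)))"

definition ext_exp :: "ereal \<Rightarrow> ereal" where
  "ext_exp x = (case x of ereal r \<Rightarrow> ereal (exp r) | PInfty \<Rightarrow> \<infinity> | MInfty \<Rightarrow> 0)"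

definition growth_rate :: "'a set \<Rightarrow> ('a \<Rightarrow> 'a) \<Rightarrow> ereal" where
  "growth_rate X \<sigma> = ext_exp (limsup (\<lambda>k. ext_ln (fix_count X \<sigma> k) / ereal (real k)))"

text \<open>Sequences are indexed by \<open>k \<ge> 1\<close>; the value at \<open>0\<close> is irrelevant.\<close>

definition periodic_gcd_seq :: "nat \<Rightarrow> (nat \<Rightarrow> real) \<Rightarrow> bool" where
  "periodic_gcd_seq m a \<longleftrightarrow>
     m > 0 \<and> (\<forall>k\<ge>1. a (k + m) = a k) \<and> (\<forall>k\<ge>1. a k = a (gcd k m))"

definition padic_abs :: "nat \<Rightarrow> nat \<Rightarrow> real" where
  "padic_abs p k = (if k = 0 then 0 else 1 / real p ^ multiplicity p k)"

text \<open>The dimension \<open>n = 0\<close> is allowed for the matrix \<open>A\<close>: the empty determinant is \<open>1\<close>, which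
  is the case where the factor \<open>\<bar>det (A\<^sup>k - 1)\<bar>\<close> is absent.\<close>

definition FAD_system :: "'a set \<Rightarrow> ('a \<Rightarrow> 'a) \<Rightarrow> bool" where
  "FAD_system X \<sigma> \<longleftrightarrow> confined X \<sigma> \<and>
     (\<exists>(c :: real) (n :: nat) (A :: int mat) (r :: nat \<Rightarrow> real) (S :: nat set)
       (s :: nat \<Rightarrow> nat \<Rightarrow> real) (t :: nat \<Rightarrow> nat \<Rightarrow> real).
        c > 0 \<and>
        A \<in> carrier_mat n n \<and>
        (\<exists>m. periodic_gcd_seq m r) \<and> (\<forall>k\<ge>1. r k > 0) \<and>
        finite S \<and> (\<forall>p\<in>S. prime p) \<and>
        (\<forall>p\<in>S. (\<exists>m. coprime m p \<and> periodic_gcd_seq m (s p)) \<and> (\<forall>k\<ge>1. s p k \<ge> 0)) \<and>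
        (\<forall>p\<in>S. (\<exists>m. coprime m p \<and> periodic_gcd_seq m (t p)) \<and> (\<forall>k\<ge>1. t p k \<ge> 0)) \<and>
        (\<forall>k\<ge>1. real (fix_count X \<sigma> k) =
           c ^ k * real_of_int \<bar>Determinant.det (A ^\<^sub>m k - 1\<^sub>m n)\<bar> * r k *
           (\<Prod>p\<in>S. padic_abs p k powr s p k *
                    real p powr (- t p k * inverse (padic_abs p k)))))"

end

theory Submission
  imports Defs "Jordan_Normal_Form.Schur_Decomposition"
begin

text \<open>
  Let \<open>\<lambda>\<^sub>i\<close> be the eigenvalues of \<open>A\<close> and \<open>L = c \<Prod> max 1 \<bar>\<lambda>\<^sub>i\<bar>\<close>. Then \<open>\<sigma>\<^sub>k / L\<^sup>k = g k * h k\<close>, where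
  \<open>g\<close> collects the eigenvalues off the unit circle and tends to \<open>1\<close>, while \<open>h \<ge> 0\<close> is Bohr almost
  periodic: powers of numbers on the unit circle and periodic sequences are, and a \<open>p\<close>-adic factor is
  a uniform limit of periodic sequences. Almost periodic sequences have Cesaro means, and the mean of
  a nonnegative one that is not identically zero is positive, because it returns close to any positive
  value with positive frequency. If \<open>h\<close> vanished identically, so would all \<open>\<sigma>\<^sub>k\<close>, and the growth rate
  would be \<open>0\<close>. Finally \<open>\<sigma>\<^sub>k / L\<^sup>k\<close> is bounded with a positive mean, which forces \<open>\<Lambda> = L\<close>.
\<close>

section \<open>Almost periodic sequences\<close>

text \<open>Bohr almost periodicity in Bochner's form: the translates of \<open>f\<close> are totally bounded in the
  supremum norm. Translates to the left are unavailable on \<open>nat\<close>, so times of equal colour are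
  compared through their difference, which has to be an \<open>e\<close>-almost period; this also excludes merely
  convergent sequences, for which positivity of the mean fails.\<close>

definition almost_periodic :: "(nat \<Rightarrow> 'b::real_normed_vector) \<Rightarrow> bool" where
  "almost_periodic f \<longleftrightarrow> (\<forall>e>0. \<exists>\<chi>::nat \<Rightarrow> nat. finite (range \<chi>) \<and>
     (\<forall>j k n. j \<le> k \<longrightarrow> \<chi> j = \<chi> k \<longrightarrow> norm (f (n + (k - j)) - f n) \<le> e))"

text \<open>A finite set of colours of any type injects into \<open>nat\<close>, so later colourings
  may use residues, integer pairs or the unit type.\<close>

lemma almost_periodicI:
  fixes f :: "nat \<Rightarrow> 'b::real_normed_vector"
  assumes "\<And>e. e > 0 \<Longrightarrow> \<exists>\<chi>::nat \<Rightarrow> 'c. finite (range \<chi>) \<and>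
     (\<forall>j k n. j \<le> k \<longrightarrow> \<chi> j = \<chi> k \<longrightarrow> norm (f (n + (k - j)) - f n) \<le> e)"
  shows "almost_periodic f"
  unfolding almost_periodic_def
proof (intro allI impI)
  fix e :: real assume "e > 0"
  obtain \<chi> :: "nat \<Rightarrow> 'c" where fin: "finite (range \<chi>)"
    and \<chi>: "\<And>j k n. j \<le> k \<Longrightarrow> \<chi> j = \<chi> k \<Longrightarrow> norm (f (n + (k - j)) - f n) \<le> e"
    using assms[OF \<open>e > 0\<close>] by auto
  obtain g :: "'c \<Rightarrow> nat" where g: "inj_on g (range \<chi>)"
    using finite_imp_inj_to_nat_seg[OF fin] by blast
  have "finite (range (g \<circ> \<chi>))"
    unfolding image_comp[symmetric] using fin by simp
  moreover have "norm (f (n + (k - j)) - f n) \<le> e" if "j \<le> k" "(g \<circ> \<chi>) j = (g \<circ> \<chi>) k" for j k n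
  proof (rule \<chi>[OF that(1)])
    show "\<chi> j = \<chi> k" by (rule inj_onD[OF g]) (use that(2) in auto)
  qed
  ultimately show "\<exists>\<chi>::nat \<Rightarrow> nat. finite (range \<chi>) \<and>
     (\<forall>j k n. j \<le> k \<longrightarrow> \<chi> j = \<chi> k \<longrightarrow> norm (f (n + (k - j)) - f n) \<le> e)" by blast
qed

lemma almost_periodicD:
  assumes "almost_periodic f" "e > 0"
  obtains \<chi> :: "nat \<Rightarrow> nat" where "finite (range \<chi>)"
    "\<And>j k n. j \<le> k \<Longrightarrow> \<chi> j = \<chi> k \<Longrightarrow> norm (f (n + (k - j)) - f n) \<le> e"
  using assms unfolding almost_periodic_def by meson

text \<open>Here \<open>\<rho> k\<close> is the earliest time with the colour of \<open>k\<close>;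
  finitely many colours make these times bounded. For a colouring as in
  \<open>almost_periodic\<close>, \<open>k - \<rho> k\<close> is then an almost period leading from
  a bounded time to \<open>k\<close>.\<close>

lemma colouring_representatives:
  fixes \<chi> :: "nat \<Rightarrow> nat"
  assumes "finite (range \<chi>)"
  obtains \<rho> :: "nat \<Rightarrow> nat" and K where "\<And>k. \<rho> k \<le> k" "\<And>k. \<chi> (\<rho> k) = \<chi> k" "\<And>k. \<rho> k \<le> K"
proof
  define \<rho> where "\<rho> k = (LEAST j. \<chi> j = \<chi> k)" for k
  show "\<rho> k \<le> k" for k unfolding \<rho>_def by (rule Least_le) simp
  show "\<chi> (\<rho> k) = \<chi> k" for k unfolding \<rho>_def by (rule LeastI[of _ k]) simp
  have "range \<rho> = (\<lambda>c. LEAST j. \<chi> j = c) ` range \<chi>" by (auto simp: \<rho>_def)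
  then have "finite (range \<rho>)" using assms by simp
  then show "\<rho> k \<le> Max (range \<rho>)" for k by simp
qed

text \<open>Up to an error of \<open>1\<close>, every value already occurs among
  \<open>f 0, ..., f K\<close>.\<close>

lemma almost_periodic_bounded:
  assumes "almost_periodic f"
  obtains M where "M > 0" "\<And>k. norm (f k) \<le> M"
proof -
  obtain \<chi> :: "nat \<Rightarrow> nat" where fin: "finite (range \<chi>)"
    and \<chi>: "\<And>j k n. j \<le> k \<Longrightarrow> \<chi> j = \<chi> k \<Longrightarrow> norm (f (n + (k - j)) - f n) \<le> 1"
    by (rule almost_periodicD[OF assms, of 1]) (simp, rule that)
  obtain \<rho> K where \<rho>: "\<And>k. \<rho> k \<le> k" "\<And>k. \<chi> (\<rho> k) = \<chi> k" "\<And>k::nat. \<rho> k \<le> (K::nat)"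
    by (rule colouring_representatives[OF fin]) (rule that)
  define M where "M = (\<Sum>j\<le>K. norm (f j)) + 1"
  show thesis
  proof
    show "M > 0" unfolding M_def by (smt (verit) norm_ge_zero sum_nonneg)
    fix k
    have "norm (f (\<rho> k + (k - \<rho> k)) - f (\<rho> k)) \<le> 1" by (rule \<chi>) (use \<rho> in auto)
    then have "norm (f k - f (\<rho> k)) \<le> 1" using \<rho>(1) by simp
    moreover have "norm (f (\<rho> k)) \<le> (\<Sum>j\<le>K. norm (f j))"
      by (rule member_le_sum) (use \<rho>(3) in auto)
    ultimately show "norm (f k) \<le> M"
      unfolding M_def by (smt (verit) norm_triangle_sub)
  qed
qed

lemma almost_periodic_const: "almost_periodic (\<lambda>k. a)"
  by (rule almost_periodicI, rule exI[of _ "\<lambda>_. ()"]) auto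

lemma almost_periodic_periodic:
  assumes "m > 0" "\<And>k. f (k + m) = f k"
  shows "almost_periodic f"
proof (rule almost_periodicI, rule exI[of _ "\<lambda>k. k mod m"], intro conjI allI impI)
  have "range (\<lambda>k. k mod m) \<subseteq> {..<m}" using assms(1) by auto
  then show "finite (range (\<lambda>k. k mod m))" by (rule finite_subset) simp
  fix j k n e assume "e > (0::real)" "j \<le> k" "j mod m = k mod m"
  then have "m dvd k - j" by (metis mod_eq_dvd_iff_nat)
  then obtain q where q: "k - j = m * q" by (rule dvdE)
  have "f (n + m * q) = f n" for q
  proof (induction q)
    case (Suc q)
    then show ?case using assms(2)[of "n + m * q"] by (simp add: ac_simps)
  qed simp
  then show "norm (f (n + (k - j)) - f n) \<le> e" using q \<open>e > 0\<close> by simp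
qed

text \<open>Pairing a colouring for \<open>f\<close> with one for \<open>g\<close> gives a colouring
  for \<open>h\<close>; a tolerance of \<open>e / (2 * C)\<close> for each adds up to
  \<open>e\<close>. Closure under norms, differences and products all reduce to this.\<close>

lemma almost_periodic_lipschitz2:
  fixes f :: "nat \<Rightarrow> 'b::real_normed_vector" and g :: "nat \<Rightarrow> 'c::real_normed_vector"
    and h :: "nat \<Rightarrow> 'd::real_normed_vector"
  assumes "almost_periodic f" "almost_periodic g" "C > 0"
    and "\<And>j k. norm (h j - h k) \<le> C * (norm (f j - f k) + norm (g j - g k))"
  shows "almost_periodic h"
proof (rule almost_periodicI)
  fix e :: real assume "e > 0"
  then have e: "e / (2 * C) > 0" using assms(3) by simp
  obtain \<chi> :: "nat \<Rightarrow> nat" where 1: "finite (range \<chi>)"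
    "\<And>j k n. j \<le> k \<Longrightarrow> \<chi> j = \<chi> k \<Longrightarrow> norm (f (n + (k - j)) - f n) \<le> e / (2 * C)"
    by (rule almost_periodicD[OF assms(1) e]) (rule that)
  obtain \<chi>' :: "nat \<Rightarrow> nat" where 2: "finite (range \<chi>')"
    "\<And>j k n. j \<le> k \<Longrightarrow> \<chi>' j = \<chi>' k \<Longrightarrow> norm (g (n + (k - j)) - g n) \<le> e / (2 * C)"
    by (rule almost_periodicD[OF assms(2) e]) (rule that)
  have "finite (range (\<lambda>k. (\<chi> k, \<chi>' k)))"
    by (rule finite_subset[of _ "range \<chi> \<times> range \<chi>'"]) (use 1 2 in auto)
  moreover have "norm (h (n + (k - j)) - h n) \<le> e"
    if "j \<le> k" "(\<chi> j, \<chi>' j) = (\<chi> k, \<chi>' k)" for j k n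
  proof -
    have "norm (h (n + (k - j)) - h n) \<le> C * (e / (2 * C) + e / (2 * C))"
      by (rule order_trans[OF assms(4)], rule mult_left_mono, rule add_mono)
        (use 1(2) 2(2) that assms(3) in auto)
    then show ?thesis using assms(3) by (simp add: field_simps)
  qed
  ultimately show "\<exists>\<chi>::nat \<Rightarrow> nat \<times> nat. finite (range \<chi>) \<and>
     (\<forall>j k n. j \<le> k \<longrightarrow> \<chi> j = \<chi> k \<longrightarrow> norm (h (n + (k - j)) - h n) \<le> e)"
    by (intro exI[of _ "\<lambda>k. (\<chi> k, \<chi>' k)"]) blast
qed

lemma almost_periodic_norm:
  assumes "almost_periodic f"
  shows "almost_periodic (\<lambda>k. norm (f k))"
  by (rule almost_periodic_lipschitz2[OF assms almost_periodic_const[of "0::real"], of 1])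
    (auto intro: norm_triangle_ineq3)

lemma almost_periodic_diff:
  assumes "almost_periodic f" "almost_periodic g"
  shows "almost_periodic (\<lambda>k. f k - g k)"
proof (rule almost_periodic_lipschitz2[OF assms, of 1])
  fix j k
  have "f j - g j - (f k - g k) = (f j - f k) - (g j - g k)" by simp
  then show "norm (f j - g j - (f k - g k)) \<le> 1 * (norm (f j - f k) + norm (g j - g k))"
    by (metis norm_triangle_ineq4 mult_1)
qed simp

text \<open>Multiplication is Lipschitz on bounded sets, and almost periodic sequences are
  bounded.\<close>

lemma almost_periodic_mult:
  fixes f g :: "nat \<Rightarrow> 'b::real_normed_algebra"
  assumes "almost_periodic f" "almost_periodic g"
  shows "almost_periodic (\<lambda>k. f k * g k)"
proof -
  obtain M where M: "M > 0" "\<And>k. norm (f k) \<le> M" by (rule almost_periodic_bounded[OF assms(1)]) (rule that, auto)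
  obtain N where N: "N > 0" "\<And>k. norm (g k) \<le> N" by (rule almost_periodic_bounded[OF assms(2)]) (rule that, auto)
  show ?thesis
  proof (rule almost_periodic_lipschitz2[OF assms, of "M + N"])
    fix j k
    have "f j * g j - f k * g k = f j * (g j - g k) + (f j - f k) * g k" by (simp add: algebra_simps)
    also have "norm \<dots> \<le> norm (f j) * norm (g j - g k) + norm (f j - f k) * norm (g k)"
      by (intro order_trans[OF norm_triangle_ineq] add_mono norm_mult_ineq)
    also have "\<dots> \<le> (M + N) * norm (g j - g k) + norm (f j - f k) * (M + N)"
      using M N by (intro add_mono mult_mono) (auto intro: add_increasing add_increasing2 less_imp_le)
    finally show "norm (f j * g j - f k * g k) \<le> (M + N) * (norm (f j - f k) + norm (g j - g k))"
      by (simp add: algebra_simps)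
  qed (use M N in auto)
qed

lemma almost_periodic_prod:
  fixes f :: "'i \<Rightarrow> nat \<Rightarrow> 'b::{real_normed_algebra,comm_ring_1}"
  assumes "\<And>i. i \<in> I \<Longrightarrow> almost_periodic (f i)"
  shows "almost_periodic (\<lambda>k. \<Prod>i\<in>I. f i k)"
  using assms
  by (induction I rule: infinite_finite_induct) (auto intro: almost_periodic_const almost_periodic_mult)

text \<open>Colour \<open>k\<close> by the cell containing \<open>z ^ k\<close> in a square grid of
  mesh \<open>1 / N\<close>. Multiplication by a power of \<open>z\<close> is an isometry, so
  \<open>z ^ j\<close> close to \<open>z ^ k\<close> makes \<open>z ^ (k - j)\<close> close to
  \<open>1\<close>, and the shift is then small at every \<open>n\<close>.\<close>

lemma almost_periodic_unit_power:
  fixes z :: complex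
  assumes "norm z = 1"
  shows "almost_periodic (\<lambda>k. z ^ k)"
proof (rule almost_periodicI)
  fix e :: real assume "e > 0"
  \<comment> \<open>Real and imaginary parts each contribute at most \<open>1 / N\<close>, so
    \<open>2 / N \<le> e\<close> is what is required.\<close>
  obtain N :: nat where N: "2 / e < real N" using reals_Archimedean2 by blast
  have "N > 0" using N \<open>e > 0\<close> by (cases N) (auto simp: field_simps)
  define \<chi> where "\<chi> k = (\<lfloor>Re (z ^ k) * N\<rfloor>, \<lfloor>Im (z ^ k) * N\<rfloor>)" for k
  have n1: "norm (z ^ k) = 1" for k using assms by (simp add: norm_power)
  have bd: "\<lfloor>x * N\<rfloor> \<in> {- int N..int N}" if "\<bar>x\<bar> \<le> 1" for x :: real
  proof -
    have "x * real N \<le> real N" "- real N \<le> x * real N"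
      using that mult_right_mono[of x 1 "real N"] mult_right_mono[of "- 1" x "real N"] by auto
    then show ?thesis by (simp add: floor_le_iff le_floor_iff)
  qed
  have "range \<chi> \<subseteq> {- int N..int N} \<times> {- int N..int N}"
    using bd abs_Re_le_cmod abs_Im_le_cmod n1 unfolding \<chi>_def by (smt (verit) image_subsetI mem_Sigma_iff)
  then have "finite (range \<chi>)" by (rule finite_subset) simp
  moreover have "norm (z ^ (n + (k - j)) - z ^ n) \<le> e" if "j \<le> k" "\<chi> j = \<chi> k" for j k n
  proof -
    have close: "\<bar>x - y\<bar> \<le> 1 / N" if "\<lfloor>x * N\<rfloor> = \<lfloor>y * N\<rfloor>" for x y :: real
    proof -
      have "\<bar>x * N - y * N\<bar> < 1" using that by linarith
      then have "\<bar>x - y\<bar> * N < 1" by (simp add: left_diff_distrib[symmetric] abs_mult)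
      then show ?thesis using \<open>N > 0\<close> by (simp add: field_simps)
    qed
    have "norm (z ^ k - z ^ j) \<le> \<bar>Re (z ^ k - z ^ j)\<bar> + \<bar>Im (z ^ k - z ^ j)\<bar>"
      by (rule cmod_le)
    also have "\<dots> \<le> 1 / N + 1 / N"
      using close that(2) by (intro add_mono) (auto simp: \<chi>_def)
    also have "\<dots> \<le> e" using N \<open>N > 0\<close> \<open>e > 0\<close> by (simp add: field_simps)
    finally have 1: "norm (z ^ k - z ^ j) \<le> e" .
    have "z ^ k - z ^ j = z ^ j * (z ^ (k - j) - 1)"
      using that(1) by (simp add: right_diff_distrib power_add[symmetric])
    then have "norm (z ^ (k - j) - 1) = norm (z ^ k - z ^ j)" using n1 by (simp add: norm_mult)
    moreover have "z ^ (n + (k - j)) - z ^ n = z ^ n * (z ^ (k - j) - 1)"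
      by (simp add: right_diff_distrib power_add)
    ultimately show ?thesis using 1 n1 by (simp add: norm_mult)
  qed
  ultimately show "\<exists>\<chi>::nat \<Rightarrow> int \<times> int. finite (range \<chi>) \<and>
     (\<forall>j k n. j \<le> k \<longrightarrow> \<chi> j = \<chi> k \<longrightarrow> norm (z ^ (n + (k - j)) - z ^ n) \<le> e)" by blast
qed

text \<open>Sums over windows of length \<open>n\<close> depend on the starting point only up to
  \<open>n * e + D\<close>, with \<open>D\<close> independent of both. Replacing the start
  \<open>k\<close> by \<open>\<rho> k\<close> costs \<open>e\<close> per term; moving the bounded
  start \<open>\<rho> k\<close> to \<open>0\<close> costs at most \<open>2 * M\<close> per
  unit.\<close>

lemma almost_periodic_window_sums:
  fixes f :: "nat \<Rightarrow> real"
  assumes "almost_periodic f" "e > 0"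
  obtains D where "D \<ge> 0" "\<And>k n. \<bar>(\<Sum>i<n. f (k + i)) - (\<Sum>i<n. f i)\<bar> \<le> real n * e + D"
proof -
  obtain M where M: "M > 0" "\<And>k. \<bar>f k\<bar> \<le> M" by (rule almost_periodic_bounded[OF assms(1)]) (rule that, auto)
  obtain \<chi> :: "nat \<Rightarrow> nat" where fin: "finite (range \<chi>)"
    and \<chi>: "\<And>j k n. j \<le> k \<Longrightarrow> \<chi> j = \<chi> k \<Longrightarrow> norm (f (n + (k - j)) - f n) \<le> e"
    by (rule almost_periodicD[OF assms]) (rule that)
  obtain \<rho> K where \<rho>: "\<And>k. \<rho> k \<le> k" "\<And>k. \<chi> (\<rho> k) = \<chi> k" "\<And>k::nat. \<rho> k \<le> (K::nat)"
    by (rule colouring_representatives[OF fin]) (rule that)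
  \<comment> \<open>Advancing the start by one drops one term and gains another, each at most
    \<open>M\<close> in absolute value.\<close>
  have shift: "\<bar>(\<Sum>i<n. f (r + i)) - (\<Sum>i<n. f i)\<bar> \<le> real r * (2 * M)" for r n
  proof (induction r)
    case (Suc r)
    have "(\<Sum>i<n. f (Suc r + i)) + f r = (\<Sum>i<n. f (r + i)) + f (r + n)"
      by (induction n) auto
    then show ?case using Suc M(2)[of r] M(2)[of "r + n"] by (simp add: algebra_simps abs_le_iff)
  qed simp
  show thesis
  proof
    show "real K * (2 * M) \<ge> 0" using M by simp
    fix k n
    have "\<bar>f (k + i) - f (\<rho> k + i)\<bar> \<le> e" for i
      using \<chi>[of "\<rho> k" k "\<rho> k + i"] \<rho>(1)[of k] \<rho>(2)[of k] by (simp add: algebra_simps)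
    then have "\<bar>\<Sum>i<n. f (k + i) - f (\<rho> k + i)\<bar> \<le> (\<Sum>i<n. e)"
      by (intro order_trans[OF sum_abs] sum_mono)
    moreover have "real (\<rho> k) * (2 * M) \<le> real K * (2 * M)"
      using \<rho>(3) M by (intro mult_right_mono) auto
    ultimately show "\<bar>(\<Sum>i<n. f (k + i)) - (\<Sum>i<n. f i)\<bar> \<le> real n * e + real K * (2 * M)"
      using shift[of "\<rho> k" n] by (simp only: sum_subtractf sum_constant card_lessThan)
  qed
qed

text \<open>By the window estimate, the mean over \<open>m * n\<close> terms is within
  \<open>\<epsilon> / 4 + D / n\<close> of the mean over \<open>n\<close> terms, and symmetrically
  for \<open>m\<close>. Once \<open>D / m\<close> and \<open>D / n\<close> are below
  \<open>\<epsilon> / 4\<close>, the two means differ by less than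
  \<open>\<epsilon>\<close>.\<close>

lemma almost_periodic_mean_convergent:
  fixes f :: "nat \<Rightarrow> real"
  assumes "almost_periodic f"
  shows "convergent (\<lambda>n. (\<Sum>i<n. f i) / n)"
proof (rule Cauchy_convergent, rule metric_CauchyI)
  fix \<epsilon> :: real assume "\<epsilon> > 0"
  define S where "S n = (\<Sum>i<n. f i)" for n
  obtain D where D: "D \<ge> 0" "\<And>k n. \<bar>(\<Sum>i<n. f (k + i)) - S n\<bar> \<le> real n * (\<epsilon> / 4) + D"
    by (rule almost_periodic_window_sums[OF assms, of "\<epsilon> / 4"])
      (use \<open>\<epsilon> > 0\<close> in simp, rule that, auto simp: S_def)
  \<comment> \<open>Cutting a window of length \<open>m * n\<close> into blocks both ways compares the means over \<open>m\<close> and \<open>n\<close>.\<close>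
  have blocks: "\<bar>S (m * n) - m * S n\<bar> \<le> m * (n * (\<epsilon> / 4) + D)" for m n
  proof (induction m)
    case (Suc m)
    have "S (a + b) = S a + (\<Sum>i<b. f (a + i))" for a b
      unfolding S_def by (induction b) (auto simp: algebra_simps)
    from this[of "m * n" n] have "S (Suc m * n) = S (m * n) + (\<Sum>i<n. f (m * n + i))"
      by (simp add: add.commute)
    then have "S (Suc m * n) - Suc m * S n
        = (S (m * n) - m * S n) + ((\<Sum>i<n. f (m * n + i)) - S n)"
      by (simp add: algebra_simps)
    also have "\<bar>\<dots>\<bar> \<le> m * (n * (\<epsilon> / 4) + D) + (n * (\<epsilon> / 4) + D)"
      by (intro order_trans[OF abs_triangle_ineq] add_mono Suc D(2))
    finally show ?case by (simp only: of_nat_Suc distrib_right mult_1)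
  qed (simp add: S_def)
  obtain N :: nat where N: "4 * D / \<epsilon> < real N" using reals_Archimedean2 by blast
  have "dist (S m / m) (S n / n) < \<epsilon>" if "m \<ge> Suc N" "n \<ge> Suc N" for m n
  proof -
    have pos: "real m > 0" "real n > 0" using that by auto
    have small: "D < \<epsilon> / 4 * real k" if "k \<ge> Suc N" for k
    proof -
      have "4 * D / \<epsilon> < real k" using N that by linarith
      then show ?thesis using \<open>\<epsilon> > 0\<close> by (simp add: field_simps)
    qed
    have "\<bar>n * S m - m * S n\<bar> \<le> m * (n * (\<epsilon> / 4) + D) + n * (m * (\<epsilon> / 4) + D)"
      using blocks[of m n] blocks[of n m] by (simp add: mult.commute abs_le_iff)
    also have "\<dots> < m * (n * (\<epsilon> / 4) + \<epsilon> / 4 * n) + n * (m * (\<epsilon> / 4) + \<epsilon> / 4 * m)"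
    proof (rule add_strict_mono)
      show "m * (n * (\<epsilon> / 4) + D) < m * (n * (\<epsilon> / 4) + \<epsilon> / 4 * n)"
        using small[OF that(2)] pos by simp
      show "n * (m * (\<epsilon> / 4) + D) < n * (m * (\<epsilon> / 4) + \<epsilon> / 4 * m)"
        using small[OF that(1)] pos by simp
    qed
    also have "\<dots> = \<epsilon> * (m * n)" by (simp add: algebra_simps)
    finally have "\<bar>n * S m - m * S n\<bar> / (m * n) < \<epsilon>" using pos by (simp add: divide_less_eq)
    moreover have "S m / m - S n / n = (n * S m - m * S n) / (m * n)" using pos by (simp add: field_simps)
    ultimately show ?thesis using pos by (simp add: dist_real_def abs_divide)
  qed
  then show "\<exists>M. \<forall>m\<ge>M. \<forall>n\<ge>M. dist ((\<Sum>i<m. f i) / m) ((\<Sum>i<n. f i) / n) < \<epsilon>"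
    unfolding S_def by blast
qed

text \<open>Quantitatively, the mean is at least \<open>a / (2 * N)\<close>, where
  \<open>a = f k0\<close> and \<open>N\<close> counts the colours needed for tolerance
  \<open>a / 2\<close>.\<close>

lemma almost_periodic_mean_pos:
  fixes f :: "nat \<Rightarrow> real"
  assumes "almost_periodic f" "\<And>k. f k \<ge> 0" "f k0 > 0"
    and "(\<lambda>n. (\<Sum>i<n. f i) / n) \<longlonglongrightarrow> B"
  shows "B > 0"
proof -
  define a where "a = f k0"
  have "a / 2 > 0" using assms(3) by (simp add: a_def)
  obtain \<chi> :: "nat \<Rightarrow> nat" where fin: "finite (range \<chi>)"
    and \<chi>: "\<And>j k n. j \<le> k \<Longrightarrow> \<chi> j = \<chi> k \<Longrightarrow> norm (f (n + (k - j)) - f n) \<le> a / 2"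
    by (rule almost_periodicD[OF assms(1) \<open>a / 2 > 0\<close>]) (rule that)
  define N where "N = card (range \<chi>)"
  have "N > 0" using fin by (simp add: N_def card_gt_0_iff)
  \<comment> \<open>The most frequent colour supplies at least \<open>n / N\<close> almost periods, and after each of them \<open>f\<close>
    is back near \<open>a\<close>.\<close>
  have lower: "(\<Sum>i<n + k0. f i) \<ge> a / 2 * n / N" for n
  proof -
    define cls where "cls c = {k. k < n \<and> \<chi> k = c}" for c
    have "\<exists>c. real n / N \<le> card (cls c)"
    proof (rule ccontr)
      assume "\<not> ?thesis"
      then have "real (card (cls c)) < real n / N" for c by (simp add: not_le)
      then have "(\<Sum>c\<in>range \<chi>. real (card (cls c))) < (\<Sum>c\<in>range \<chi>. real n / N)"
        using fin by (intro sum_strict_mono) auto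
      also have "\<dots> = n" using \<open>N > 0\<close> by (simp add: N_def)
      finally have *: "(\<Sum>c\<in>range \<chi>. card (cls c)) < n" by (simp flip: of_nat_sum)
      have "(\<Union>c\<in>range \<chi>. cls c) = {..<n}" by (auto simp: cls_def)
      moreover have "card (\<Union>c\<in>range \<chi>. cls c) \<le> (\<Sum>c\<in>range \<chi>. card (cls c))"
        by (rule card_UN_le[OF fin])
      ultimately show False using * by simp
    qed
    then obtain c where c: "real n / N \<le> card (cls c)" by blast
    define j0 where "j0 = (LEAST j. \<chi> j = c)"
    have j0: "j0 \<le> k" "\<chi> j0 = \<chi> k" if "k \<in> cls c" for k
      using that by (auto simp: cls_def j0_def intro: Least_le LeastI)
    have "a / 2 * n / N = (a / 2) * (n / N)" by simp
    also have "\<dots> \<le> (a / 2) * card (cls c)" using c \<open>a / 2 > 0\<close> by (intro mult_left_mono) auto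
    also have "\<dots> = (\<Sum>k\<in>cls c. a / 2)" by simp
    also have "\<dots> \<le> (\<Sum>k\<in>cls c. f (k0 + (k - j0)))"
    proof (rule sum_mono)
      fix k assume "k \<in> cls c"
      then have "\<bar>f (k0 + (k - j0)) - a\<bar> \<le> a / 2" using \<chi>[OF j0] unfolding a_def by force
      then show "a / 2 \<le> f (k0 + (k - j0))" by linarith
    qed
    \<comment> \<open>Since \<open>j0 \<le> k\<close> on the class, truncated subtraction is
      injective there: the return times are distinct and below \<open>n + k0\<close>. Nonnegativity
      of \<open>f\<close> then allows the missing indices to be filled in.\<close>
    also have "\<dots> = sum f ((\<lambda>k. k0 + (k - j0)) ` cls c)"
    proof (subst sum.reindex)
      have "x = y" if "x \<in> cls c" "y \<in> cls c" "x - j0 = y - j0" for x y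
        using j0(1)[OF that(1)] j0(1)[OF that(2)] that(3) by linarith
      then show "inj_on (\<lambda>k. k0 + (k - j0)) (cls c)" by (auto simp: inj_on_def)
    qed simp
    also have "\<dots> \<le> (\<Sum>i<n + k0. f i)"
      by (rule sum_mono2) (auto simp: cls_def assms(2))
    finally show ?thesis .
  qed
  have "(\<lambda>n. (\<Sum>i<n + k0. f i) / (n + k0)) \<longlonglongrightarrow> B"
    using LIMSEQ_ignore_initial_segment[OF assms(4), of k0] by simp
  moreover have "(\<lambda>n. a / (2 * N) * (n / (n + k0))) \<longlonglongrightarrow> a / (2 * N) * 1"
  proof (intro tendsto_mult tendsto_const)
    have "(\<lambda>n. 1 - k0 * inverse (real (n + k0))) \<longlonglongrightarrow> 1 - real k0 * 0"
      using LIMSEQ_ignore_initial_segment[OF lim_inverse_n, of k0] by (intro tendsto_intros) auto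
    moreover have "eventually (\<lambda>n. 1 - k0 * inverse (real (n + k0)) = n / (n + k0)) sequentially"
      using eventually_gt_at_top[of 0] by eventually_elim (auto simp: field_simps)
    ultimately show "(\<lambda>n. real n / real (n + k0)) \<longlonglongrightarrow> 1"
      using Lim_transform_eventually by fastforce
  qed
  moreover have "a / (2 * N) * (n / (n + k0)) \<le> (\<Sum>i<n + k0. f i) / (n + k0)" for n
  proof -
    have "a / (2 * N) * (n / (n + k0)) = (a / 2 * n / N) / (n + k0)" by simp
    also have "\<dots> \<le> (\<Sum>i<n + k0. f i) / (n + k0)" using lower by (intro divide_right_mono) auto
    finally show ?thesis .
  qed
  ultimately have "a / (2 * N) * 1 \<le> B" by (intro LIMSEQ_le) auto
  moreover have "a / (2 * N) > 0" using \<open>a / 2 > 0\<close> \<open>N > 0\<close> by simp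
  ultimately show ?thesis by linarith
qed

section \<open>Determinants of \<open>A\<^sup>k - 1\<close>\<close>

text \<open>In entry \<open>(i, j)\<close> of the product \<open>B ^\<^sub>m k * B\<close> only the
  indices \<open>l\<close> with \<open>i \<le> l \<le> j\<close> survive: none below the diagonal,
  and one on it.\<close>

lemma upper_triangular_pow:
  fixes B :: "'b::comm_semiring_1 mat"
  assumes "B \<in> carrier_mat n n" "upper_triangular B"
  shows "upper_triangular (B ^\<^sub>m k) \<and> (\<forall>i<n. (B ^\<^sub>m k) $$ (i, i) = (B $$ (i, i)) ^ k)"
proof (induction k)
  case 0
  then show ?case using assms by auto
next
  case (Suc k)
  have C: "B ^\<^sub>m k \<in> carrier_mat n n" using assms by simp
  have el: "(B ^\<^sub>m Suc k) $$ (i, j) = (\<Sum>l<n. (B ^\<^sub>m k) $$ (i, l) * B $$ (l, j))"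
    if "i < n" "j < n" for i j
    using that C assms(1) by (simp add: scalar_prod_def lessThan_atLeast0)
  have z: "(B ^\<^sub>m k) $$ (i, l) * B $$ (l, j) = 0" if "i < n" "l < n" "l < i \<or> j < l" for i j l
    using that Suc C assms by (auto dest: upper_triangularD)
  have "(B ^\<^sub>m Suc k) $$ (i, j) = 0" if "i < n" "j < i" for i j
    using that by (subst el) (auto intro!: sum.neutral z)
  moreover have "(B ^\<^sub>m Suc k) $$ (i, i) = (B $$ (i, i)) ^ Suc k" if "i < n" for i
  proof -
    have "(B ^\<^sub>m Suc k) $$ (i, i) = (\<Sum>l\<in>{i}. (B ^\<^sub>m k) $$ (i, l) * B $$ (l, i))"
      unfolding el[OF that that] by (rule sum.mono_neutral_right) (use that in \<open>auto intro!: z\<close>)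
    then show ?thesis using Suc that by (simp add: mult.commute)
  qed
  ultimately show ?case using assms(1) C by auto
qed

text \<open>One triangularisation of \<open>A\<close> over the complex numbers serves all
  \<open>k\<close>: the same \<open>P\<close> and \<open>Q\<close> conjugate every power and fix the
  identity. Hence the numbers \<open>l i\<close>, the diagonal of the Schur form, do not depend on
  \<open>k\<close>.\<close>

lemma det_pow_minus_one:
  fixes A :: "int mat"
  assumes A: "A \<in> carrier_mat n n"
  shows "\<exists>l :: nat \<Rightarrow> complex. \<forall>k.
    real_of_int \<bar>Determinant.det (A ^\<^sub>m k - 1\<^sub>m n)\<bar> = (\<Prod>i<n. norm (l i ^ k - 1))"
proof -
  let ?h = "of_int :: int \<Rightarrow> complex"
  define A' where "A' = map_mat ?h A"
  have A': "A' \<in> carrier_mat n n" using A by (simp add: A'_def)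
  obtain es where es: "char_poly A' = (\<Prod>a\<leftarrow>es. [:- a, 1:])" using char_poly_factorized[OF A'] by blast
  obtain B P Q where "schur_decomposition A' es = (B, P, Q)" by (metis prod_cases3)
  from schur_decomposition[OF A' es this] have sim: "similar_mat_wit A' B P Q" and ut: "upper_triangular B"
    by auto
  note w = similar_mat_witD2[OF A' sim]
  show ?thesis
  proof (intro exI[of _ "\<lambda>i. B $$ (i, i)"] allI)
    fix k
    have Ak: "A' ^\<^sub>m k \<in> carrier_mat n n" and Bk: "B ^\<^sub>m k \<in> carrier_mat n n" using A' w by auto
    have simk: "similar_mat_wit (A' ^\<^sub>m k) (B ^\<^sub>m k) P Q" by (rule similar_mat_wit_pow[OF sim])
    have "A' ^\<^sub>m k - 1\<^sub>m n = P * (B ^\<^sub>m k - 1\<^sub>m n) * Q"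
    proof -
      have "P * (B ^\<^sub>m k - 1\<^sub>m n) * Q = P * B ^\<^sub>m k * Q - P * Q"
        using w Bk by (simp add: mult_minus_distrib_mat[of _ n n _ n] minus_mult_distrib_mat[of _ n n _ _ n])
      then show ?thesis using similar_mat_witD2[OF Ak simk] by simp
    qed
    then have "similar_mat_wit (A' ^\<^sub>m k - 1\<^sub>m n) (B ^\<^sub>m k - 1\<^sub>m n) P Q"
      using w Ak Bk by (intro similar_mat_witI[of _ _ n]) auto
    then have "Determinant.det (A' ^\<^sub>m k - 1\<^sub>m n) = Determinant.det (B ^\<^sub>m k - 1\<^sub>m n)"
      by (intro det_similar) (auto simp: similar_mat_def)
    also have "\<dots> = prod_list (diag_mat (B ^\<^sub>m k - 1\<^sub>m n))"
      using upper_triangular_pow[OF w(5) ut, of k] Bk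
      by (intro det_upper_triangular[of _ n]) (auto simp: upper_triangular_def)
    also have "\<dots> = (\<Prod>i<n. (B $$ (i, i)) ^ k - 1)"
      using upper_triangular_pow[OF w(5) ut, of k] Bk
      by (auto simp: prod_list_diag_prod lessThan_atLeast0)
    finally have *: "Determinant.det (A' ^\<^sub>m k - 1\<^sub>m n) = (\<Prod>i<n. (B $$ (i, i)) ^ k - 1)" .
    have "A' ^\<^sub>m k - 1\<^sub>m n = map_mat ?h (A ^\<^sub>m k - 1\<^sub>m n)"
    proof -
      have "A' ^\<^sub>m k = map_mat ?h (A ^\<^sub>m k)"
        unfolding A'_def by (rule of_int_hom.mat_hom_pow[OF A, symmetric])
      then show ?thesis using A by (auto intro!: eq_matI)
    qed
    then have "?h (Determinant.det (A ^\<^sub>m k - 1\<^sub>m n)) = (\<Prod>i<n. (B $$ (i, i)) ^ k - 1)"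
      using * by simp
    then have "norm (?h (Determinant.det (A ^\<^sub>m k - 1\<^sub>m n))) = (\<Prod>i<n. norm ((B $$ (i, i)) ^ k - 1))"
      by (simp add: prod_norm)
    then show "real_of_int \<bar>Determinant.det (A ^\<^sub>m k - 1\<^sub>m n)\<bar> = (\<Prod>i<n. norm ((B $$ (i, i)) ^ k - 1))"
      by (simp only: norm_of_int)
  qed
qed

section \<open>Local factors\<close>

lemma periodic_gcd_seq_add_mult:
  assumes "periodic_gcd_seq m a" "k \<ge> 1" "m dvd d"
  shows "a (k + d) = a k"
proof -
  obtain q where d: "d = m * q" using assms(3) by (rule dvdE)
  have "a (k + m * q) = a k"
  proof (induction q)
    case (Suc q)
    have "a (k + m * q + m) = a (k + m * q)" using assms(1,2) unfolding periodic_gcd_seq_def by simp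
    then show ?case using Suc by (simp add: ac_simps)
  qed simp
  then show ?thesis using d by simp
qed

text \<open>The sequence takes only finitely many values, so its positive values stay away from
  \<open>0\<close>.\<close>

lemma periodic_gcd_seq_gap:
  assumes "periodic_gcd_seq m a" "\<And>k. k \<ge> 1 \<Longrightarrow> a k \<ge> 0"
  obtains \<eta> where "\<eta> > 0" "\<And>k. k \<ge> 1 \<Longrightarrow> a k = 0 \<or> a k \<ge> \<eta>"
proof -
  \<comment> \<open>Inserting \<open>1\<close> keeps \<open>Min V\<close> meaningful when the
    sequence vanishes identically.\<close>
  define V where "V = insert 1 {x \<in> a ` {1..m}. x > 0}"
  have V: "finite V" "V \<noteq> {}" by (auto simp: V_def)
  show thesis
  proof
    show "Min V > 0" using V by (auto simp: V_def)
    fix k :: nat assume k: "k \<ge> 1"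
    have m: "m > 0" and g: "a k = a (gcd k m)" using assms(1) k unfolding periodic_gcd_seq_def by auto
    have "gcd k m \<in> {1..m}" using m by (auto simp: Suc_le_eq intro: gcd_le2_nat)
    then have "a k \<in> a ` {1..m}" using g by auto
    then have "a k > 0 \<Longrightarrow> Min V \<le> a k" using V by (intro Min_le) (auto simp: V_def)
    then show "a k = 0 \<or> a k \<ge> Min V" using assms(2)[OF k] by linarith
  qed
qed

lemma padic_abs_powr:
  assumes "prime p" "k \<ge> 1"
  shows "padic_abs p k powr x = real p powr (- (real (multiplicity p k) * x))"
    and "inverse (padic_abs p k) = real p ^ multiplicity p k"
proof -
  have "real p > 0" using assms(1) prime_gt_0_nat by simp
  then show "padic_abs p k powr x = real p powr (- (real (multiplicity p k) * x))"
    using assms(2) by (simp add: padic_abs_def powr_realpow[symmetric] powr_minus_divide[symmetric] powr_powr)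
  show "inverse (padic_abs p k) = real p ^ multiplicity p k"
    using assms(2) by (simp add: padic_abs_def)
qed

text \<open>With \<open>v\<close> the valuation of \<open>k\<close>, the factor is \<open>p\<close>
  to the power \<open>-(v * s + t * p ^ v)\<close>. As \<open>v \<le> p ^ v\<close>, either of
  \<open>s \<ge> \<eta>\<close> and \<open>t \<ge> \<eta>\<close> makes the bracket at least
  \<open>\<eta> * V\<close>.\<close>

lemma padic_factor_bounds:
  fixes s t \<eta> :: real
  assumes "prime p" "k \<ge> 1" "s \<ge> 0" "t \<ge> 0" "\<eta> > 0" "s \<ge> \<eta> \<or> t \<ge> \<eta>" "V \<le> multiplicity p k"
  shows "padic_abs p k powr s * real p powr (- t * inverse (padic_abs p k)) \<in> {0..2 powr - (\<eta> * V)}"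
proof -
  define v where "v = multiplicity p k"
  have p: "real p \<ge> 2" using prime_ge_2_nat[OF assms(1)] by simp
  have "real v \<le> real p ^ v"
  proof -
    have "v < p ^ v" using prime_gt_1_nat[OF assms(1)] by (intro power_gt_expt) simp
    then show ?thesis by (metis of_nat_less_iff of_nat_power less_imp_le)
  qed
  then have "\<eta> * v \<le> v * s + t * real p ^ v"
    using assms(3-6) mult_mono[of \<eta> s v v] mult_mono[of \<eta> t v "real p ^ v"]
    by (auto simp: mult.commute intro: add_increasing add_increasing2)
  moreover have "\<eta> * V \<le> \<eta> * v" using assms(5,7) by (simp add: v_def)
  ultimately have *: "\<eta> * V \<le> v * s + t * real p ^ v" by linarith
  have "padic_abs p k powr s * real p powr (- t * inverse (padic_abs p k))
      = real p powr - (v * s + t * real p ^ v)"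
    unfolding padic_abs_powr[OF assms(1,2)] by (simp add: v_def powr_add[symmetric])
  also have "\<dots> \<le> real p powr - (\<eta> * V)" using * p by (intro powr_mono) auto
  also have "\<dots> \<le> 2 powr - (\<eta> * V)" using p assms(5) by (intro powr_mono2') auto
  finally show ?thesis by simp
qed

text \<open>Where \<open>s\<close> and \<open>t\<close> both vanish the factor is \<open>1\<close>;
  elsewhere it becomes uniformly small as the valuation grows. So up to \<open>e\<close> it depends
  only on the index modulo \<open>m * m' * p ^ V\<close>. The argument \<open>Suc k\<close> avoids
  index \<open>0\<close>, where periodicity is not assumed.\<close>

lemma almost_periodic_padic_factor:
  assumes p: "prime p"
    and s: "periodic_gcd_seq m s" "\<And>k. k \<ge> 1 \<Longrightarrow> s k \<ge> 0"
    and t: "periodic_gcd_seq m' t" "\<And>k. k \<ge> 1 \<Longrightarrow> t k \<ge> 0"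
  shows "almost_periodic (\<lambda>k. padic_abs p (Suc k) powr s (Suc k) *
           real p powr (- t (Suc k) * inverse (padic_abs p (Suc k))))"
proof (rule almost_periodicI)
  define F where "F k = padic_abs p k powr s k * real p powr (- t k * inverse (padic_abs p k))" for k
  fix e :: real assume "e > 0"
  obtain \<eta>1 where 1: "\<eta>1 > 0" "\<And>k. k \<ge> 1 \<Longrightarrow> s k = 0 \<or> s k \<ge> \<eta>1"
    by (rule periodic_gcd_seq_gap[OF s]) (assumption, rule that)
  obtain \<eta>2 where 2: "\<eta>2 > 0" "\<And>k. k \<ge> 1 \<Longrightarrow> t k = 0 \<or> t k \<ge> \<eta>2"
    by (rule periodic_gcd_seq_gap[OF t]) (assumption, rule that)
  define \<eta> where "\<eta> = min \<eta>1 \<eta>2"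
  have \<eta>: "\<eta> > 0" "\<And>k. k \<ge> 1 \<Longrightarrow> s k = 0 \<or> s k \<ge> \<eta>" "\<And>k. k \<ge> 1 \<Longrightarrow> t k = 0 \<or> t k \<ge> \<eta>"
    using 1 2 unfolding \<eta>_def by fastforce+
  \<comment> \<open>Solves \<open>2 powr - (\<eta> * V) \<le> e\<close>: from valuation
    \<open>V\<close> on, a factor with nonzero \<open>s\<close> or \<open>t\<close> is at most
    \<open>e\<close>.\<close>
  obtain V :: nat where V: "- ln e / (\<eta> * ln 2) < V" using reals_Archimedean2 by blast
  have small: "2 powr - (\<eta> * V) \<le> e"
  proof -
    have "\<eta> * ln 2 > 0" using \<eta>(1) by simp
    then have "- ln e < V * (\<eta> * ln 2)" using V by (simp only: pos_divide_less_eq)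
    then have "ln (2 powr - (\<eta> * V)) \<le> ln e" by (simp add: ln_powr algebra_simps)
    then show ?thesis using \<open>e > 0\<close> by (subst (asm) ln_le_cancel_iff) auto
  qed
  define M where "M = m * m' * p ^ V"
  have "m > 0" "m' > 0" "p > 0" using s t p by (auto simp: periodic_gcd_seq_def prime_gt_0_nat)
  then have "M > 0" by (simp add: M_def)
  \<comment> \<open>Either \<open>v\<^sub>p(k) < V\<close> and the shift preserves it, or both valuations are at least \<open>V\<close>; in the latter
    case both values are \<open>1\<close> or both are small.\<close>
  have shift: "\<bar>F (k + d) - F k\<bar> \<le> e" if "k \<ge> 1" "M dvd d" for k d
  proof -
    have d: "m dvd d" "m' dvd d" "p ^ V dvd d" using that(2) unfolding M_def
      by (auto intro: dvd_trans[OF _ that(2)[unfolded M_def]])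
    have st: "s (k + d) = s k" "t (k + d) = t k"
      using periodic_gcd_seq_add_mult[OF s(1) that(1) d(1)] periodic_gcd_seq_add_mult[OF t(1) that(1) d(2)] by auto
    have np: "\<not> is_unit p" using p by auto
    show ?thesis
    proof (cases "p ^ V dvd k")
      case False
      define v where "v = multiplicity p k"
      have "v < V" using False multiplicity_dvd'[of V p k] by (force simp: v_def not_less)
      then have "p ^ Suc v dvd d" by (intro dvd_trans[OF le_imp_power_dvd d(3)]) simp
      then have "multiplicity p (k + d) = v"
      proof (intro multiplicity_eqI)
        have "p ^ v dvd d" using \<open>p ^ Suc v dvd d\<close> by (meson dvd_trans le_imp_power_dvd le_SucI order_refl)
        then show "p ^ v dvd k + d" by (simp add: v_def multiplicity_dvd)
        have "\<not> p ^ Suc v dvd k"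
          unfolding v_def by (subst power_dvd_iff_le_multiplicity) (use that(1) np in auto)
        then show "\<not> p ^ Suc v dvd k + d"
          by (simp only: dvd_add_left_iff[OF \<open>p ^ Suc v dvd d\<close>] not_False_eq_True)
      qed
      then have "padic_abs p (k + d) = padic_abs p k" using that(1) by (simp add: padic_abs_def v_def)
      then show ?thesis using st \<open>e > 0\<close> by (simp add: F_def)
    next
      case True
      then have "p ^ V dvd k + d" using d(3) by simp
      then have mult: "V \<le> multiplicity p k" "V \<le> multiplicity p (k + d)"
        using True that(1) np by (auto intro!: multiplicity_geI)
      show ?thesis
      proof (cases "s k = 0 \<and> t k = 0")
        case True
        have "padic_abs p j \<noteq> 0" if "j \<ge> 1" for j
          using that \<open>p > 0\<close> by (simp add: padic_abs_def)
        then show ?thesis using True st that(1) \<open>e > 0\<close> \<open>p > 0\<close> by (simp add: F_def)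
      next
        case False
        then have big: "s k \<ge> \<eta> \<or> t k \<ge> \<eta>" using \<eta> that(1) by blast
        have "F k \<in> {0..e}" "F (k + d) \<in> {0..e}"
          using padic_factor_bounds[OF p that(1) s(2)[OF that(1)] t(2)[OF that(1)] \<eta>(1) big mult(1)]
            padic_factor_bounds[OF p _ s(2)[OF that(1)] t(2)[OF that(1)] \<eta>(1) big mult(2)]
            small st that(1) by (auto simp: F_def)
        then show ?thesis by auto
      qed
    qed
  qed
  have "range (\<lambda>k. k mod M) \<subseteq> {..<M}" using \<open>M > 0\<close> by auto
  then have fin: "finite (range (\<lambda>k. k mod M))" by (rule finite_subset) simp
  have "norm (F (Suc (n + (k - j))) - F (Suc n)) \<le> e" if "j \<le> k" "j mod M = k mod M" for j k n
    using shift[of "Suc n" "k - j"] that mod_eq_dvd_iff_nat[of j k M] by simp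
  with fin show "\<exists>\<chi>::nat \<Rightarrow> nat. finite (range \<chi>) \<and> (\<forall>j k n. j \<le> k \<longrightarrow> \<chi> j = \<chi> k \<longrightarrow>
      norm (padic_abs p (Suc (n + (k - j))) powr s (Suc (n + (k - j))) *
           real p powr (- t (Suc (n + (k - j))) * inverse (padic_abs p (Suc (n + (k - j))))) -
        padic_abs p (Suc n) powr s (Suc n) *
           real p powr (- t (Suc n) * inverse (padic_abs p (Suc n)))) \<le> e)"
    unfolding F_def by (intro exI[of _ "\<lambda>k. k mod M"]) blast
qed

text \<open>Inside the unit disc the powers of \<open>z\<close> die out; outside, division by
  \<open>z ^ Suc k\<close> leaves \<open>1 - inverse z ^ Suc k\<close>. This yields the limit
  \<open>1\<close> of the factor \<open>g\<close> in the main proof.\<close>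

lemma normalised_power_factor_tendsto:
  fixes z :: complex
  assumes "norm z \<noteq> 1"
  shows "(\<lambda>k. norm (z ^ Suc k - 1) / max 1 (norm z) ^ Suc k) \<longlonglongrightarrow> 1"
proof (cases "norm z < 1")
  case True
  have "(\<lambda>k. norm (z ^ Suc k - 1)) \<longlonglongrightarrow> norm (0 - 1 :: complex)"
    by (intro tendsto_intros LIMSEQ_Suc LIMSEQ_power_zero True)
  then show ?thesis using True by (simp add: max_def)
next
  case False
  then have gt: "norm z > 1" using assms by simp
  have eq: "norm (z ^ Suc k - 1) / max 1 (norm z) ^ Suc k = norm (1 - inverse z ^ Suc k)" for k
  proof -
    have "1 - inverse z ^ Suc k = (z ^ Suc k - 1) / z ^ Suc k"
      using gt by (auto simp: diff_divide_distrib power_one_over inverse_eq_divide simp del: power_Suc)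
    then have "norm (1 - inverse z ^ Suc k) = norm (z ^ Suc k - 1) / norm z ^ Suc k"
      by (simp only: norm_divide norm_power)
    then show ?thesis using gt by (simp only: max_absorb2 less_imp_le)
  qed
  have "(\<lambda>k. norm (1 - inverse z ^ Suc k)) \<longlonglongrightarrow> norm (1 - 0 :: complex)"
    by (intro tendsto_intros LIMSEQ_Suc LIMSEQ_power_zero) (use gt in \<open>simp add: norm_inverse inverse_less_1_iff\<close>)
  then show ?thesis unfolding eq by simp
qed

section \<open>Means and growth\<close>

text \<open>Serves twice: to discard the error made by replacing \<open>g\<close> with its limit,
  and to rule out exponential decay of the normalised counts.\<close>

lemma mean_tendsto_zero:
  fixes f :: "nat \<Rightarrow> real"
  assumes "f \<longlonglongrightarrow> 0"
  shows "(\<lambda>n. (\<Sum>i<n. f i) / n) \<longlonglongrightarrow> 0"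
proof (rule LIMSEQ_I)
  fix r :: real assume "r > 0"
  then obtain N where N: "\<And>n. n \<ge> N \<Longrightarrow> \<bar>f n\<bar> < r / 2"
    using LIMSEQ_D[OF assms, of "r / 2"] by auto
  define C where "C = (\<Sum>i<N. \<bar>f i\<bar>)"
  obtain M :: nat where M: "2 * C / r < M" using reals_Archimedean2 by blast
  have "norm ((\<Sum>i<n. f i) / n - 0) < r" if "n \<ge> N + M + 1" for n
  proof -
    \<comment> \<open>The first \<open>N\<close> terms contribute the constant \<open>C\<close>, all
      others at most \<open>r / 2\<close> each.\<close>
    have "\<bar>\<Sum>i<n. f i\<bar> \<le> (\<Sum>i<n. (if i < N then \<bar>f i\<bar> else 0) + r / 2)"
      by (rule order_trans[OF sum_abs], rule sum_mono) (use N \<open>r > 0\<close> in \<open>auto simp: not_less less_imp_le\<close>)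
    also have "\<dots> = C + n * (r / 2)"
      using that by (auto simp: sum.distrib C_def sum.If_cases intro!: sum.cong)
    also have "\<dots> < n * (r / 2) + n * (r / 2)"
    proof -
      have "2 * C / r < n" using M that by linarith
      then show ?thesis using \<open>r > 0\<close> by (simp add: field_simps)
    qed
    finally show ?thesis using that by (simp add: abs_divide field_simps)
  qed
  then show "\<exists>no. \<forall>n\<ge>no. norm ((\<Sum>i<n. f i) / n - 0) < r" by blast
qed

text \<open>Passes from integer to real cutoffs: the sum stops at the floor of \<open>Y\<close>, and
  the floor divided by \<open>Y\<close> tends to \<open>1\<close>.\<close>

lemma mean_tendsto_at_top:
  fixes b :: "nat \<Rightarrow> real"
  assumes "(\<lambda>n. (\<Sum>i<n. b (Suc i)) / n) \<longlonglongrightarrow> B"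
  shows "((\<lambda>Y::real. 1 / Y * (\<Sum>k | 1 \<le> k \<and> real k \<le> Y. b k)) \<longlongrightarrow> B) at_top"
proof -
  define N where "N Y = nat \<lfloor>Y\<rfloor>" for Y :: real
  have N: "filterlim N sequentially at_top"
    unfolding N_def by (rule filterlim_compose[OF filterlim_nat_sequentially filterlim_floor_sequentially])
  have ratio: "((\<lambda>Y. N Y / Y) \<longlongrightarrow> 1) at_top"
  proof (rule tendsto_sandwich)
    show "eventually (\<lambda>Y. 1 - inverse Y \<le> N Y / Y) at_top"
      using eventually_gt_at_top[of 1]
    proof eventually_elim
      case (elim Y)
      have "Y - 1 \<le> N Y" unfolding N_def by linarith
      then have "(Y - 1) / Y \<le> N Y / Y" using elim by (intro divide_right_mono) auto
      then show ?case using elim by (simp add: diff_divide_distrib inverse_eq_divide)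
    qed
    show "eventually (\<lambda>Y. N Y / Y \<le> 1) at_top"
      using eventually_gt_at_top[of 1]
    proof eventually_elim
      case (elim Y)
      have "N Y \<le> Y" unfolding N_def using elim by linarith
      then show ?case using elim by (simp add: field_simps)
    qed
    have "((\<lambda>Y::real. 1 - inverse Y) \<longlongrightarrow> 1 - 0) at_top"
      by (intro tendsto_intros tendsto_inverse_0_at_top filterlim_ident)
    then show "((\<lambda>Y::real. 1 - inverse Y) \<longlongrightarrow> 1) at_top" by simp
  qed simp
  have "((\<lambda>Y. (\<Sum>i<N Y. b (Suc i)) / N Y * (N Y / Y)) \<longlongrightarrow> B * 1) at_top"
    by (intro tendsto_mult ratio filterlim_compose[OF assms N])
  moreover have "eventually (\<lambda>Y. (\<Sum>i<N Y. b (Suc i)) / N Y * (N Y / Y)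
      = 1 / Y * (\<Sum>k | 1 \<le> k \<and> real k \<le> Y. b k)) at_top"
    using eventually_gt_at_top[of 1]
  proof eventually_elim
    case (elim Y)
    have "{k. 1 \<le> k \<and> real k \<le> Y} = {1..N Y}"
      unfolding N_def using elim by (auto simp: le_nat_iff le_floor_iff nat_le_iff)
    also have "\<dots> = Suc ` {..<N Y}" by (simp add: lessThan_atLeast0 image_Suc_atLeastLessThan atLeastLessThanSuc_atLeastAtMost)
    finally have "(\<Sum>k | 1 \<le> k \<and> real k \<le> Y. b k) = (\<Sum>i<N Y. b (Suc i))"
      by (simp add: sum.reindex)
    moreover have "N Y > 0" unfolding N_def using elim by simp
    ultimately show ?case by simp
  qed
  ultimately show ?thesis using Lim_transform_eventually by fastforce
qed

text \<open>Boundedness of the normalised counts gives the upper bound on the limsup. If it were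
  below \<open>ln L\<close>, those counts would decay geometrically and their mean would be
  \<open>0\<close>, contrary to \<open>B \<noteq> 0\<close>.\<close>

lemma limsup_ext_ln_eq:
  fixes N :: "nat \<Rightarrow> nat"
  assumes L: "L > 0"
    and bound: "\<And>k. N (Suc k) / L ^ Suc k \<le> M" and M: "M > 0"
    and mean: "(\<lambda>n. (\<Sum>i<n. N (Suc i) / L ^ Suc i) / n) \<longlonglongrightarrow> B" and B: "B \<noteq> 0"
  shows "limsup (\<lambda>k. ext_ln (N k) / ereal (real k)) = ereal (ln L)"
proof (rule antisym)
  have "limsup (\<lambda>k. ext_ln (N k) / ereal (real k)) \<le> limsup (\<lambda>k. ereal (ln M / k + ln L))"
  proof (rule Limsup_mono, use eventually_gt_at_top[of 0] in eventually_elim)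
    case (elim k)
    show ?case
    \<comment> \<open>For a zero count the left side is \<open>-\<infinity>\<close>, so the
      comparison is trivial.\<close>
    proof (cases "N k = 0")
      case False
      have "N k \<le> M * L ^ k" using bound[of "k - 1"] elim L by (simp add: divide_le_eq)
      then have "ln (N k) \<le> ln (M * L ^ k)" using False by (subst ln_le_cancel_iff) (use L M in auto)
      also have "\<dots> = ln M + k * ln L" using L M by (simp add: ln_mult ln_realpow)
      finally have "ln (N k) / k \<le> ln M / k + ln L" using elim by (simp add: field_simps)
      then show ?thesis using False elim by (simp add: ext_ln_def)
    qed (use elim in \<open>simp add: ext_ln_def\<close>)
  qed
  also have "(\<lambda>k. ln M / real k + ln L) \<longlonglongrightarrow> 0 + ln L"
    by (intro tendsto_intros lim_const_over_n)
  then have "limsup (\<lambda>k. ereal (ln M / k + ln L)) = ereal (ln L)"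
    by (intro lim_imp_Limsup) auto
  finally show "limsup (\<lambda>k. ext_ln (N k) / ereal (real k)) \<le> ereal (ln L)" .
  show "ereal (ln L) \<le> limsup (\<lambda>k. ext_ln (N k) / ereal (real k))"
  proof (rule ccontr)
    assume "\<not> ?thesis"
    then have "limsup (\<lambda>k. ext_ln (N k) / ereal (real k)) < ereal (ln L)" by (simp only: not_le)
    from ereal_dense2[OF this] obtain y
      where y: "limsup (\<lambda>k. ext_ln (N k) / ereal (real k)) < ereal y" "y < ln L" by auto
    define q where "q = exp y / L"
    have "exp y < L" using y(2) L by (metis exp_less_cancel_iff exp_ln)
    then have q: "0 < q" "q < 1" using L by (auto simp: q_def)
    have "eventually (\<lambda>k. N k / L ^ k \<le> q ^ k) sequentially"
      using Limsup_lessD[OF y(1)] eventually_gt_at_top[of 0]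
    proof eventually_elim
      case (elim k)
      have "N k \<le> exp y ^ k"
      proof (cases "N k = 0")
        case False
        then have "ln (N k) / k < y" using elim by (simp add: ext_ln_def)
        then have "ln (N k) < k * y" using elim by (simp add: field_simps)
        then have "N k < exp (k * y)" using False by (metis exp_less_cancel_iff exp_ln of_nat_0_less_iff neq0_conv)
        then show ?thesis by (simp add: exp_of_nat_mult)
      qed simp
      then show ?case using L by (simp add: q_def power_divide divide_right_mono)
    qed
    then have "eventually (\<lambda>k. norm (N k / L ^ k) \<le> norm (q ^ k) * 1) sequentially"
      by eventually_elim (use L q in simp)
    moreover have "(\<lambda>k. q ^ k) \<longlonglongrightarrow> 0" by (rule LIMSEQ_power_zero) (use q in simp)
    ultimately have "(\<lambda>k. N k / L ^ k) \<longlonglongrightarrow> 0" by (rule tendsto_0_le[rotated])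
    from mean_tendsto_zero[OF LIMSEQ_Suc[OF this]]
    show False using LIMSEQ_unique[OF mean] B by blast
  qed
qed

section \<open>Growth rate and Cesaro mean of a FAD-system\<close>

theorem theorem3:
  fixes X :: "'a set" and \<sigma> :: "'a \<Rightarrow> 'a"
  assumes "FAD_system X \<sigma>"
    and "growth_rate X \<sigma> > 1"
  shows "growth_rate X \<sigma> < \<infinity> \<and>
    (\<exists>B::real. B > 0 \<and>
      ((\<lambda>Y::real. 1 / Y * (\<Sum>k | 1 \<le> k \<and> real k \<le> Y.
            real (fix_count X \<sigma> k) / real_of_ereal (growth_rate X \<sigma>) ^ k))
        \<longlongrightarrow> B) at_top)"
proof -
  define N where "N = fix_count X \<sigma>"
  \<comment> \<open>A named predicate for the defining conditions lets the seven witnesses be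
    obtained before its body is unfolded.\<close>
  define P where "P c n A r S s t \<longleftrightarrow> c > 0 \<and>
        A \<in> carrier_mat n n \<and>
        (\<exists>m. periodic_gcd_seq m r) \<and> (\<forall>k\<ge>1. r k > 0) \<and>
        finite S \<and> (\<forall>p\<in>S. prime p) \<and>
        (\<forall>p\<in>S. (\<exists>m. coprime m p \<and> periodic_gcd_seq m (s p)) \<and> (\<forall>k\<ge>1. s p k \<ge> 0)) \<and>
        (\<forall>p\<in>S. (\<exists>m. coprime m p \<and> periodic_gcd_seq m (t p)) \<and> (\<forall>k\<ge>1. t p k \<ge> 0)) \<and>
        (\<forall>k\<ge>1. real (N k) =
           c ^ k * real_of_int \<bar>Determinant.det (A ^\<^sub>m k - 1\<^sub>m n)\<bar> * r k *
           (\<Prod>p\<in>S. padic_abs p k powr s p k *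
                    real p powr (- t p k * inverse (padic_abs p k))))"
    for c :: real and n :: nat and A :: "int mat" and r :: "nat \<Rightarrow> real" and S :: "nat set"
      and s t :: "nat \<Rightarrow> nat \<Rightarrow> real"
  have "\<exists>c n A r S s t. P c n A r S s t"
    using assms(1) unfolding FAD_system_def P_def N_def by (rule conjunct2)
  then obtain c n A r S s t where "P c n A r S s t" by blast
  note fad = this[unfolded P_def]
  then have c: "c > 0" and A: "A \<in> carrier_mat n n"
    and r: "\<exists>m. periodic_gcd_seq m r" "\<And>k. k \<ge> 1 \<Longrightarrow> r k > 0"
    and S: "\<And>p. p \<in> S \<Longrightarrow> prime p"
    and s: "\<And>p. p \<in> S \<Longrightarrow> \<exists>m. periodic_gcd_seq m (s p)" "\<And>p k. p \<in> S \<Longrightarrow> k \<ge> 1 \<Longrightarrow> s p k \<ge> 0"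
    and t: "\<And>p. p \<in> S \<Longrightarrow> \<exists>m. periodic_gcd_seq m (t p)" "\<And>p k. p \<in> S \<Longrightarrow> k \<ge> 1 \<Longrightarrow> t p k \<ge> 0"
    by blast+
  have N: "real (N k) =
           c ^ k * real_of_int \<bar>Determinant.det (A ^\<^sub>m k - 1\<^sub>m n)\<bar> * r k *
           (\<Prod>p\<in>S. padic_abs p k powr s p k * real p powr (- t p k * inverse (padic_abs p k)))"
    if "k \<ge> 1" for k
    using fad that by blast
  obtain m where m: "periodic_gcd_seq m r" using r(1) by blast
  from det_pow_minus_one[OF A] obtain l :: "nat \<Rightarrow> complex"
    where "\<forall>k. real_of_int \<bar>Determinant.det (A ^\<^sub>m k - 1\<^sub>m n)\<bar> = (\<Prod>i<n. norm (l i ^ k - 1))" ..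
  then have l: "real_of_int \<bar>Determinant.det (A ^\<^sub>m k - 1\<^sub>m n)\<bar> = (\<Prod>i<n. norm (l i ^ k - 1))" for k
    by (rule spec)
  \<comment> \<open>The candidate for the growth rate: \<open>l i\<close> contributes its modulus
    when that exceeds \<open>1\<close>, and \<open>1\<close> otherwise.\<close>
  define L where "L = c * (\<Prod>i<n. max 1 (norm (l i)))"
  have L: "L > 0" unfolding L_def using c by (intro mult_pos_pos prod_pos) auto
  define I where "I = {i. i < n \<and> norm (l i) = 1}"
  \<comment> \<open>From here on, index \<open>k\<close> of \<open>w\<close>, \<open>F\<close>,
    \<open>g\<close> and \<open>h\<close> refers to the iterate \<open>Suc k\<close>, since the
    formula for \<open>N\<close> starts at \<open>1\<close>.\<close>
  define w where "w i k = norm (l i ^ Suc k - 1) / max 1 (norm (l i)) ^ Suc k" for i k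
  define F where "F p k = padic_abs p (Suc k) powr s p (Suc k) *
           real p powr (- t p (Suc k) * inverse (padic_abs p (Suc k)))" for p k
  define g where "g k = (\<Prod>i\<in>{..<n} - I. w i k)" for k
  define h where "h k = (\<Prod>i\<in>I. w i k) * r (Suc k) * (\<Prod>p\<in>S. F p k)" for k
  have I: "I \<subseteq> {..<n}" by (auto simp: I_def)
  have factor: "N (Suc k) / L ^ Suc k = g k * h k" for k
  proof -
    define P where "P = (\<Prod>i<n. norm (l i ^ Suc k - 1))"
    define D where "D = (\<Prod>i<n. max 1 (norm (l i))) ^ Suc k"
    have "P / D = (\<Prod>i<n. w i k)"
      unfolding P_def D_def w_def by (simp only: prod_dividef prod_power_distrib)
    also have "\<dots> = g k * (\<Prod>i\<in>I. w i k)"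
      unfolding g_def using I by (intro prod.subset_diff) auto
    finally have PD: "P / D = g k * (\<Prod>i\<in>I. w i k)" .
    have "1 \<le> Suc k" by simp
    from N[OF this] have "real (N (Suc k)) = c ^ Suc k * P * r (Suc k) * (\<Prod>p\<in>S. F p k)"
      unfolding l F_def P_def .
    moreover have "L ^ Suc k = c ^ Suc k * D"
      unfolding L_def D_def by (rule power_mult_distrib)
    ultimately have "N (Suc k) / L ^ Suc k = P / D * r (Suc k) * (\<Prod>p\<in>S. F p k)"
      using c by simp
    then show ?thesis unfolding PD h_def by (simp only: mult.assoc)
  qed
  have ap: "almost_periodic h"
    unfolding h_def
  proof (intro almost_periodic_mult almost_periodic_prod)
    fix i assume "i \<in> I"
    then have 1: "norm (l i) = 1" by (simp add: I_def)
    \<comment> \<open>Splitting off one factor \<open>l i\<close> brings \<open>l i ^ Suc k\<close>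
      within reach of the closure rules.\<close>
    have "almost_periodic (\<lambda>k. norm (l i * l i ^ k - 1))"
      by (intro almost_periodic_norm almost_periodic_diff almost_periodic_mult almost_periodic_const
          almost_periodic_unit_power 1)
    then show "almost_periodic (w i)" unfolding w_def[abs_def] using 1 by simp
  next
    show "almost_periodic (\<lambda>k. r (Suc k))"
    proof (rule almost_periodic_periodic)
      show "m > 0" using m by (simp add: periodic_gcd_seq_def)
      show "r (Suc (k + m)) = r (Suc k)" for k
        using periodic_gcd_seq_add_mult[OF m, of "Suc k" m] by simp
    qed
  next
    fix p assume p: "p \<in> S"
    obtain m1 where m1: "periodic_gcd_seq m1 (s p)" using s(1)[OF p] by blast
    obtain m2 where m2: "periodic_gcd_seq m2 (t p)" using t(1)[OF p] by blast
    show "almost_periodic (F p)"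
      unfolding F_def[abs_def] by (rule almost_periodic_padic_factor[OF S[OF p] m1 s(2)[OF p] m2 t(2)[OF p]])
  qed
  have h0: "h k \<ge> 0" for k
    unfolding h_def w_def F_def using r(2)[of "Suc k"] by (intro mult_nonneg_nonneg prod_nonneg) auto
  have glim: "g \<longlonglongrightarrow> 1"
  proof -
    have "(\<lambda>k. \<Prod>i\<in>{..<n} - I. w i k) \<longlonglongrightarrow> (\<Prod>i\<in>{..<n} - I. 1)"
      unfolding w_def by (intro tendsto_prod normalised_power_factor_tendsto) (auto simp: I_def)
    then show ?thesis by (simp add: g_def[abs_def])
  qed
  obtain M where M: "M > 0" "\<And>k. norm (h k) \<le> M" by (rule almost_periodic_bounded[OF ap]) (rule that)
  obtain G where G: "G > 0" "\<And>k. norm (g k) \<le> G"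
    using convergent_imp_Bseq[OF convergentI[OF glim]] by (auto simp: Bseq_def)
  obtain B where B: "(\<lambda>n. (\<Sum>i<n. h i) / n) \<longlonglongrightarrow> B"
    using almost_periodic_mean_convergent[OF ap] by (auto simp: convergent_def)
  \<comment> \<open>If all counts vanished, the convention \<open>ext_ln 0 = -\<infinity>\<close>
    would give growth rate \<open>0\<close>, against the hypothesis.\<close>
  have "\<exists>k. N (Suc k) \<noteq> 0"
  proof (rule ccontr)
    assume "\<nexists>k. N (Suc k) \<noteq> 0"
    then have "eventually (\<lambda>k. ext_ln (N k) / ereal (real k) = -\<infinity>) sequentially"
      by (intro eventually_mono[OF eventually_gt_at_top[of 0]]) (auto simp: ext_ln_def gr0_conv_Suc)
    then have "limsup (\<lambda>k. ext_ln (N k) / ereal (real k)) = limsup (\<lambda>k. -\<infinity>)"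
      by (rule Limsup_eq)
    then show False using assms(2) by (simp add: growth_rate_def N_def ext_exp_def Limsup_const)
  qed
  then obtain k0 where "N (Suc k0) \<noteq> 0" by blast
  then have "h k0 \<noteq> 0" using factor[of k0] L by auto
  then have "h k0 > 0" using h0[of k0] by simp
  then have Bpos: "B > 0" by (rule almost_periodic_mean_pos[OF ap h0 _ B])
  \<comment> \<open>Writing \<open>g * h = h + (g - 1) * h\<close> with \<open>h\<close> bounded,
    the second summand has mean \<open>0\<close>, so the normalised counts share the mean
    \<open>B\<close> of \<open>h\<close>.\<close>
  have "(\<lambda>k. (g k - 1) * h k) \<longlonglongrightarrow> 0"
  proof (rule tendsto_0_le)
    show "(\<lambda>k. g k - 1) \<longlonglongrightarrow> 0" using glim by (simp add: LIM_zero_iff)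
    show "eventually (\<lambda>k. norm ((g k - 1) * h k) \<le> norm (g k - 1) * M) sequentially"
      using M by (intro always_eventually allI) (simp add: abs_mult mult_left_mono)
  qed
  moreover have "(\<Sum>i<n. (g i - 1) * h i) / n + (\<Sum>i<n. h i) / n = (\<Sum>i<n. g i * h i) / n" for n
    by (simp add: left_diff_distrib sum_subtractf diff_divide_distrib)
  ultimately have mean: "(\<lambda>n. (\<Sum>i<n. N (Suc i) / L ^ Suc i) / n) \<longlonglongrightarrow> B"
    unfolding factor using tendsto_add[OF mean_tendsto_zero B, of "\<lambda>k. (g k - 1) * h k"] by simp
  have bound: "N (Suc k) / L ^ Suc k \<le> G * M" for k
  proof -
    have "norm (g k) * norm (h k) \<le> G * M" using G M by (intro mult_mono) (auto intro: less_imp_le)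
    then have "\<bar>g k * h k\<bar> \<le> G * M" by (simp add: abs_mult)
    then show ?thesis unfolding factor by (rule abs_le_D1)
  qed
  have "limsup (\<lambda>k. ext_ln (N k) / ereal (real k)) = ereal (ln L)"
    by (rule limsup_ext_ln_eq[OF L bound _ mean]) (use G(1) M(1) Bpos in simp_all)
  then have "growth_rate X \<sigma> = ereal L"
    using L by (simp add: growth_rate_def N_def ext_exp_def)
  then show ?thesis
    using Bpos mean_tendsto_at_top[OF mean] by (auto simp: N_def)
qed

end
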